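(* For every integer $k\ge 0$, the Coxeter system $\mathbf{I_2}(2k+1)$ is cube-like.
   Context: $\mathbf{I_2}(m)$ is the Coxeter system $(W,\{s,t\})$ with $W=\langle s,t\mid s^2=t^2=(st)^m=1\rangle$ (the dihedral group of order $2m$; its Cayley graph is a cycle of length $2m$, and for $m=1$ it is a single edge). For a Coxeter system $(W,S)$: $\ell(w)$ is the word length w.r.t. $S$; for $J\subseteq S$, $W_J=\langle J\rangle$, $W^J=\{w\in W\mid \ell(wj)>\ell(w)\ \forall j\in J\}$, and $G(W^J)$ is the graph on $W^J$ with $w\sim w'$ iff $w'=sw$ for some $s\in S$. $\iota_0(H)=\max\{|A|-|B|\mid V(H)=A\sqcup B,\ A,B\text{ independent}\}$. $(W,S)$ is cube-like if there is $J\subseteq S$ with $W_J$ abelian and $\iota_0(G(W^J))>0$. *)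

theory Defs
  imports "HOL-Algebra.Elementary_Groups"
begin

section \<open>Groups given by generators and relators\<close>

text \<open>Words are lists of signed letters: \<open>(a, True)\<close> stands for \<open>a\<close> and \<open>(a, False)\<close> for its
  formal inverse.  Two words represent the same element of the group with generators
  \<open>UNIV :: 'a set\<close> and relators \<open>R\<close> iff they are related by the least congruence for
  concatenation that cancels inverse letters and trivialises every relator.\<close>

type_synonym 'a word = "('a \<times> bool) list"

inductive word_eq :: "'a word set \<Rightarrow> 'a word \<Rightarrow> 'a word \<Rightarrow> bool" for R :: "'a word set" where
  refl: "word_eq R x x"
| sym: "word_eq R x y \<Longrightarrow> word_eq R y x"
| trans: "word_eq R x y \<Longrightarrow> word_eq R y z \<Longrightarrow> word_eq R x z"
| cong: "word_eq R x x' \<Longrightarrow> word_eq R y y' \<Longrightarrow> word_eq R (x @ y) (x' @ y')"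
| cancel: "word_eq R [(a, b), (a, \<not> b)] []"
| relator: "r \<in> R \<Longrightarrow> word_eq R r []"

definition word_class :: "'a word set \<Rightarrow> 'a word \<Rightarrow> 'a word set" where
  "word_class R x = {y. word_eq R x y}"

definition presented_group :: "'a word set \<Rightarrow> 'a word set monoid" where
  "presented_group R =
    \<lparr>carrier = range (word_class R),
     mult = (\<lambda>A B. \<Union>x\<in>A. \<Union>y\<in>B. word_class R (x @ y)),
     one = word_class R []\<rparr>"

lemma word_class_eq_iff: "word_class R x = word_class R y \<longleftrightarrow> word_eq R x y"
proof
  assume "word_class R x = word_class R y"
  moreover have "y \<in> word_class R y"
    by (simp add: word_class_def word_eq.refl)
  ultimately show "word_eq R x y"
    by (auto simp: word_class_def)
next
  assume "word_eq R x y"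
  then show "word_class R x = word_class R y"
    by (auto simp: word_class_def dest: word_eq.sym intro: word_eq.trans)
qed

lemma mult_word_class:
  "word_class R x \<otimes>\<^bsub>presented_group R\<^esub> word_class R y = word_class R (x @ y)"
proof -
  have *: "word_class R (x' @ y') = word_class R (x @ y)"
    if "x' \<in> word_class R x" "y' \<in> word_class R y" for x' y'
  proof -
    have "word_eq R x x'" "word_eq R y y'"
      using that by (simp_all add: word_class_def)
    then have "word_eq R (x @ y) (x' @ y')"
      by (rule word_eq.cong)
    then show ?thesis
      by (simp add: word_class_eq_iff word_eq.sym)
  qed
  have "x \<in> word_class R x" "y \<in> word_class R y"
    by (simp_all add: word_class_def word_eq.refl)
  then have "(\<Union>x'\<in>word_class R x. \<Union>y'\<in>word_class R y. word_class R (x' @ y'))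
      = word_class R (x @ y)"
    using * by blast
  then show ?thesis
    by (simp add: presented_group_def)
qed

lemma carrier_presented_group: "carrier (presented_group R) = range (word_class R)"
  by (simp add: presented_group_def)

lemma word_eq_inverse: "\<exists>y. word_eq R (y @ x) []"
proof (induction x)
  case Nil
  show ?case by (rule exI[of _ "[]"]) (simp add: word_eq.refl)
next
  case (Cons p x)
  then obtain y where y: "word_eq R (y @ x) []" by blast
  obtain a b where p: "p = (a, b)" by (cases p)
  have "word_eq R [(a, \<not> b), (a, b)] []"
    using word_eq.cancel[of R a "\<not> b"] by simp
  then have "word_eq R ([(a, \<not> b), (a, b)] @ x) ([] @ x)"
    by (rule word_eq.cong[OF _ word_eq.refl])
  then have "word_eq R (y @ [(a, \<not> b), (a, b)] @ x) (y @ [] @ x)"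
    by (rule word_eq.cong[OF word_eq.refl])
  then have "word_eq R ((y @ [(a, \<not> b)]) @ p # x) []"
    using word_eq.trans[OF _ y] p by simp
  then show ?case by blast
qed

lemma group_presented_group: "group (presented_group R)"
proof (rule groupI)
  have car: "carrier (presented_group R) = range (word_class R)"
    and one: "\<one>\<^bsub>presented_group R\<^esub> = word_class R []"
    by (simp_all add: presented_group_def)
  show "\<one>\<^bsub>presented_group R\<^esub> \<in> carrier (presented_group R)"
    by (simp add: car one)
  fix A assume A: "A \<in> carrier (presented_group R)"
  then obtain x where x: "A = word_class R x" by (auto simp: car)
  show "\<one>\<^bsub>presented_group R\<^esub> \<otimes>\<^bsub>presented_group R\<^esub> A = A"
    by (simp add: x one mult_word_class)
  obtain y where "word_eq R (y @ x) []" using word_eq_inverse by blast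
  then show "\<exists>B\<in>carrier (presented_group R). B \<otimes>\<^bsub>presented_group R\<^esub> A = \<one>\<^bsub>presented_group R\<^esub>"
    by (auto simp: car x one mult_word_class word_class_eq_iff)
next
  fix A B C
  assume "A \<in> carrier (presented_group R)" "B \<in> carrier (presented_group R)"
  then show "A \<otimes>\<^bsub>presented_group R\<^esub> B \<in> carrier (presented_group R)"
    by (auto simp: mult_word_class carrier_presented_group)
  moreover assume "C \<in> carrier (presented_group R)"
  ultimately show "A \<otimes>\<^bsub>presented_group R\<^esub> B \<otimes>\<^bsub>presented_group R\<^esub> C
      = A \<otimes>\<^bsub>presented_group R\<^esub> (B \<otimes>\<^bsub>presented_group R\<^esub> C)"
    using \<open>A \<in> _\<close> \<open>B \<in> _\<close> by (auto simp: mult_word_class carrier_presented_group)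
qed


section \<open>The Coxeter systems \<open>I\<^sub>2(m)\<close>\<close>

datatype dihedral_letter = Ls | Lt

text \<open>The relators are the words \<open>ss\<close>, \<open>tt\<close> and \<open>(st)\<^sup>m\<close>.\<close>

definition I2_relators :: "nat \<Rightarrow> dihedral_letter word set" where
  "I2_relators m =
    {[(Ls, True), (Ls, True)],
     [(Lt, True), (Lt, True)],
     concat (replicate m [(Ls, True), (Lt, True)])}"

definition I2_group :: "nat \<Rightarrow> dihedral_letter word set monoid" where
  "I2_group m = presented_group (I2_relators m)"

text \<open>The generators \<open>s\<close>, \<open>t\<close> are elements of the group; they coincide when \<open>m = 1\<close>.\<close>

definition I2_gens :: "nat \<Rightarrow> dihedral_letter word set set" where
  "I2_gens m = {word_class (I2_relators m) [(Ls, True)], word_class (I2_relators m) [(Lt, True)]}"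


section \<open>Length, minimal coset representatives, and the graph on them\<close>

text \<open>In a Coxeter system every generator is an involution, so words need no inverse letters.\<close>

definition word_length :: "('a, 'b) monoid_scheme \<Rightarrow> 'a set \<Rightarrow> 'a \<Rightarrow> nat" where
  "word_length W S w =
    (LEAST n. \<exists>xs. set xs \<subseteq> S \<and> length xs = n \<and> foldr (mult W) xs \<one>\<^bsub>W\<^esub> = w)"

definition min_coset_reps :: "('a, 'b) monoid_scheme \<Rightarrow> 'a set \<Rightarrow> 'a set \<Rightarrow> 'a set" where
  "min_coset_reps W S J =
    {w \<in> carrier W. \<forall>j\<in>J. word_length W S (w \<otimes>\<^bsub>W\<^esub> j) > word_length W S w}"

definition left_adj :: "('a, 'b) monoid_scheme \<Rightarrow> 'a set \<Rightarrow> 'a \<Rightarrow> 'a \<Rightarrow> bool" where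
  "left_adj W S w w' \<longleftrightarrow> (\<exists>s\<in>S. w' = s \<otimes>\<^bsub>W\<^esub> w)"


section \<open>Imbalance of bipartitions and cube-likeness\<close>

definition independent_set :: "('a \<Rightarrow> 'a \<Rightarrow> bool) \<Rightarrow> 'a set \<Rightarrow> bool" where
  "independent_set E A \<longleftrightarrow> (\<forall>a\<in>A. \<forall>b\<in>A. \<not> E a b)"

text \<open>Meaningful for finite bipartite graphs only: otherwise the maximum is over an empty set,
  or cardinalities of infinite sets occur.\<close>

definition iota0 :: "'a set \<Rightarrow> ('a \<Rightarrow> 'a \<Rightarrow> bool) \<Rightarrow> int" where
  "iota0 V E =
    Max {int (card A) - int (card B) | A B.
      A \<union> B = V \<and> A \<inter> B = {} \<and> independent_set E A \<and> independent_set E B}"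

definition cube_like :: "('a, 'b) monoid_scheme \<Rightarrow> 'a set \<Rightarrow> bool" where
  "cube_like W S \<longleftrightarrow>
    (\<exists>J\<subseteq>S. comm_group (subgroup_generated W J) \<and>
      iota0 (min_coset_reps W S J) (left_adj W S) > 0)"

end

theory Submission
  imports Defs "HOL-Algebra.Multiplicative_Group"
begin

text \<open>
  Take \<open>J = {s}\<close>.  Multiplication by a generator changes the parity of the word length, so exactly
  one of \<open>w\<close>, \<open>w s\<close> is a minimal coset representative, and \<open>W\<^sup>J\<close> has as many
  elements as the set of even elements of \<open>W\<close>.  The even elements form the cyclic group generated
  by \<open>s t\<close>, whose order divides the odd number \<open>2 k + 1\<close>.  Hence \<open>W\<^sup>J\<close> has an odd number
  of elements, and the two parity classes, which are independent, have different sizes.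
\<close>

section \<open>Imbalance of a graph with a given bipartition\<close>

lemma iota0_pos:
  assumes "finite A" "finite B" "A \<inter> B = {}" "independent_set E A" "independent_set E B"
    and "card A \<noteq> card B"
  shows "iota0 (A \<union> B) E > 0"
proof -
  define D where "D = {int (card C) - int (card C') | C C'.
    C \<union> C' = A \<union> B \<and> C \<inter> C' = {} \<and> independent_set E C \<and> independent_set E C'}"
  \<comment> \<open>\<open>Max\<close> is informative only on finite sets; here every value comes
    from a pair of subsets of the finite set \<open>A \<union> B\<close>.\<close>
  have "D \<subseteq> (\<lambda>(C, C'). int (card C) - int (card C')) ` (Pow (A \<union> B) \<times> Pow (A \<union> B))"
    by (fastforce simp: D_def)
  then have "finite D"
    using assms(1,2) by (meson finite_Pow_iff finite_SigmaI finite_UnI finite_imageI finite_subset)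
  \<comment> \<open>The bipartition may be read in either order, and one of the two opposite
    differences is positive.\<close>
  moreover have "int (card A) - int (card B) \<in> D" "int (card B) - int (card A) \<in> D"
    unfolding D_def using assms(3-5) by blast+
  ultimately have "int (card A) - int (card B) \<le> Max D" "int (card B) - int (card A) \<le> Max D"
    by simp_all
  then show ?thesis
    using assms(6) unfolding iota0_def D_def by linarith
qed

section \<open>Groups generated by involutions, with a parity on the elements\<close>

locale parity_group = group W for W (structure) +
  fixes S E :: "'a set"
  assumes gens_closed: "S \<subseteq> carrier W"
    and gens_involution: "a \<in> S \<Longrightarrow> a \<otimes> a = \<one>"
    and gens_generate: "w \<in> carrier W \<Longrightarrow> \<exists>xs. set xs \<subseteq> S \<and> foldr (\<otimes>) xs \<one> = w"
    and even_closed: "E \<subseteq> carrier W"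
    and one_even: "\<one> \<in> E"
    and mult_even_iff: "a \<in> S \<Longrightarrow> w \<in> carrier W \<Longrightarrow> a \<otimes> w \<in> E \<longleftrightarrow> w \<notin> E"
begin

lemma foldr_closed: "set xs \<subseteq> S \<Longrightarrow> foldr (\<otimes>) xs \<one> \<in> carrier W"
  by (induction xs) (use gens_closed in auto)

text \<open>This is what the abstract set \<open>E\<close> is postulated for: words with the same
  value have lengths of the same parity, so parity belongs to the group element.\<close>

lemma foldr_even_iff: "set xs \<subseteq> S \<Longrightarrow> foldr (\<otimes>) xs \<one> \<in> E \<longleftrightarrow> even (length xs)"
  by (induction xs) (auto simp: one_even mult_even_iff foldr_closed)

lemma foldr_snoc:
  "set xs \<subseteq> S \<Longrightarrow> a \<in> S \<Longrightarrow> foldr (\<otimes>) (xs @ [a]) \<one> = foldr (\<otimes>) xs \<one> \<otimes> a"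
  by (induction xs) (use gens_closed in \<open>auto simp: m_assoc subset_iff foldr_closed\<close>)

lemma word_length_even_iff:
  assumes "w \<in> carrier W"
  shows "even (word_length W S w) \<longleftrightarrow> w \<in> E"
proof -
  have "\<exists>xs. set xs \<subseteq> S \<and> length xs = word_length W S w \<and> foldr (\<otimes>) xs \<one> = w"
    \<comment> \<open>The \<open>LEAST\<close> is attained because some word for \<open>w\<close>
      exists; any word, in particular a shortest one, shows the parity of \<open>w\<close>.\<close>
    unfolding word_length_def by (rule LeastI_ex) (use gens_generate[OF assms] in blast)
  then show ?thesis
    using foldr_even_iff by metis
qed

text \<open>The locale speaks of left multiplication, which gives the edges of the graph; cosets
  need right multiplication. Appending a letter to a word changes its length by one just as
  prepending does.\<close>

lemma mult_even_iff_right: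
  assumes "w \<in> carrier W" "a \<in> S"
  shows "w \<otimes> a \<in> E \<longleftrightarrow> w \<notin> E"
proof -
  obtain xs where "set xs \<subseteq> S" "foldr (\<otimes>) xs \<one> = w"
    using gens_generate[OF assms(1)] by blast
  then show ?thesis
    using foldr_even_iff[of xs] foldr_even_iff[of "xs @ [a]"] foldr_snoc[of xs a] assms(2)
    by (simp del: foldr_append)
qed

lemma mult_gen_gen:
  assumes "w \<in> carrier W" "a \<in> S"
  shows "w \<otimes> a \<otimes> a = w"
proof -
  have "a \<in> carrier W"
    using assms(2) gens_closed by blast
  then show ?thesis
    using assms gens_involution by (simp add: m_assoc)
qed

text \<open>The lengths of \<open>w\<close> and \<open>w \<otimes> a\<close> differ in parity, hence
  are distinct, and a second multiplication by \<open>a\<close> leads back to \<open>w\<close>. So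
  the shorter of the two is the representative.\<close>

lemma min_coset_reps_mult_iff:
  assumes "w \<in> carrier W" "a \<in> S"
  shows "w \<otimes> a \<in> min_coset_reps W S {a} \<longleftrightarrow> w \<notin> min_coset_reps W S {a}"
proof -
  have "a \<in> carrier W"
    using assms(2) gens_closed by blast
  moreover have "word_length W S (w \<otimes> a) \<noteq> word_length W S w"
    using mult_even_iff_right[OF assms] word_length_even_iff[of w]
      word_length_even_iff[of "w \<otimes> a"] assms(1) calculation by auto
  ultimately show ?thesis
    using assms by (auto simp: min_coset_reps_def mult_gen_gen)
qed

lemma independent_even:
  assumes "A \<subseteq> E"
  shows "independent_set (left_adj W S) A"
  unfolding independent_set_def left_adj_def
proof (intro ballI notI)
  fix w w' assume "w \<in> A" "w' \<in> A" "\<exists>a\<in>S. w' = a \<otimes> w"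
  then obtain a where "a \<in> S" "w \<in> E" "a \<otimes> w \<in> E"
    using assms by blast
  then show False
    using mult_even_iff even_closed by blast
qed

lemma independent_odd:
  assumes "A \<subseteq> carrier W - E"
  shows "independent_set (left_adj W S) A"
  unfolding independent_set_def left_adj_def
proof (intro ballI notI)
  fix w w' assume "w \<in> A" "w' \<in> A" "\<exists>a\<in>S. w' = a \<otimes> w"
  then obtain a where "a \<in> S" "w \<in> carrier W" "w \<notin> E" "a \<otimes> w \<notin> E"
    using assms by blast
  then show False
    using mult_even_iff by blast
qed

theorem cube_like_if_odd_card:
  assumes "a \<in> S" "odd (card E)"
  shows "cube_like W S"
proof -
  define V where "V = min_coset_reps W S {a}"
  have VW: "V \<subseteq> carrier W"
    by (auto simp: V_def min_coset_reps_def)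
  have a: "a \<in> carrier W"
    using assms(1) gens_closed by blast
  have inj: "inj_on (\<lambda>w. w \<otimes> a) (carrier W)"
    using inj_on_multc[OF a] .
  have flip: "w \<otimes> a \<in> V \<longleftrightarrow> w \<notin> V" "w \<otimes> a \<in> E \<longleftrightarrow> w \<notin> E" if "w \<in> carrier W" for w
    using min_coset_reps_mult_iff mult_even_iff_right that assms(1) by (auto simp: V_def)
  \<comment> \<open>Right multiplication by \<open>a\<close> flips both parity and membership in
    \<open>V\<close>, so it matches the odd representatives with the even elements outside
    \<open>V\<close>.\<close>
  have "x \<in> (\<lambda>w. w \<otimes> a) ` (V - E)" if "x \<in> E" "x \<notin> V" for x
  proof
    have "x \<in> carrier W"
      using that even_closed by blast
    then show "x = (x \<otimes> a) \<otimes> a" "x \<otimes> a \<in> V - E"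
      using that assms(1) flip by (auto simp: mult_gen_gen)
  qed
  then have E_eq: "E = V \<inter> E \<union> (\<lambda>w. w \<otimes> a) ` (V - E)"
    using VW flip by auto
  have disj: "V \<inter> E \<inter> (\<lambda>w. w \<otimes> a) ` (V - E) = {}"
    using VW flip by auto
  \<comment> \<open>An infinite set has \<open>card\<close> 0, which is even.\<close>
  have "finite E"
    using assms(2) by (metis card.infinite even_zero)
  then have fin: "finite (V \<inter> E)" "finite ((\<lambda>w. w \<otimes> a) ` (V - E))"
    using E_eq by (metis finite_Un)+
  have inj': "inj_on (\<lambda>w. w \<otimes> a) (V - E)"
    using inj VW by (meson Diff_subset inj_on_subset)
  have "card E = card (V \<inter> E) + card (V - E)"
    using E_eq card_Un_disjoint[OF fin disj] card_image[OF inj'] by metis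
  then have "card (V \<inter> E) \<noteq> card (V - E)"
    using assms(2) by auto
  then have "iota0 (V \<inter> E \<union> (V - E)) (left_adj W S) > 0"
    using fin(1) finite_imageD[OF fin(2) inj'] VW
    by (intro iota0_pos independent_even independent_odd) auto
  moreover have "V \<inter> E \<union> (V - E) = V"
    by blast
  \<comment> \<open>The subgroup generated by the single element \<open>a\<close> is cyclic, hence
    abelian.\<close>
  ultimately show ?thesis
    unfolding cube_like_def V_def
    using group.cyclic_imp_abelian_group[OF group_subgroup_generated cyclic_group_generated] assms(1)
    by (intro exI[of _ "{a}"]) auto
qed

end

section \<open>Parity and rotations in the dihedral presentation\<close>

lemma word_eq_even_length:
  assumes "word_eq R x y" "\<And>r. r \<in> R \<Longrightarrow> even (length r)"
  shows "even (length x) \<longleftrightarrow> even (length y)"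
  using assms by (induction rule: word_eq.induct) auto

context
  fixes m :: nat
begin

private abbreviation (input) cls where "cls \<equiv> word_class (I2_relators m)"
private abbreviation (input) gs where "gs \<equiv> cls [(Ls, True)]"
private abbreviation (input) gt where "gt \<equiv> cls [(Lt, True)]"
private abbreviation (input) W where "W \<equiv> I2_group m"

definition I2_even :: "dihedral_letter word set set" where
  "I2_even = {cls x | x. even (length x)}"

lemma mult_cls: "cls x \<otimes>\<^bsub>W\<^esub> cls y = cls (x @ y)"
  by (simp add: I2_group_def mult_word_class)

lemma carrier_I2: "carrier W = range cls"
  by (simp add: I2_group_def carrier_presented_group)

lemma one_I2: "\<one>\<^bsub>W\<^esub> = cls []"
  by (simp add: I2_group_def presented_group_def)

lemma group_I2: "group W"
  by (simp add: I2_group_def group_presented_group)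

lemma I2_involution: "cls [(c, True), (c, True)] = \<one>\<^bsub>W\<^esub>"
  unfolding one_I2 word_class_eq_iff
  by (cases c) (auto intro: word_eq.relator simp: I2_relators_def)

text \<open>A letter and its formal inverse are both right inverses of the same involution, so left
  cancellation identifies them. This reduces arbitrary words to products of generators.\<close>

lemma I2_letter: "cls [(c, b)] = cls [(c, True)]"
proof (cases b)
  case False
  interpret group W by (rule group_I2)
  have "cls [(c, True)] \<otimes>\<^bsub>W\<^esub> cls [(c, False)] = cls [(c, True)] \<otimes>\<^bsub>W\<^esub> cls [(c, True)]"
    using word_eq.cancel[of "I2_relators m" c True]
    by (simp add: mult_cls I2_involution) (simp add: one_I2 word_class_eq_iff)
  then show ?thesis
    using False by (simp add: carrier_I2)
qed simp

lemma cls_Cons: "cls (p # x) = cls [(fst p, True)] \<otimes>\<^bsub>W\<^esub> cls x"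
  using mult_cls[of "[p]" x] I2_letter[of "fst p" "snd p"] by simp

lemma cls_gen: "cls [(c, True)] \<in> I2_gens m"
  by (cases c) (auto simp: I2_gens_def)

text \<open>The relators have lengths 2, 2 and \<open>2 * m\<close>, so the parity of a word does
  not depend on the representative chosen in \<open>I2_even\<close>.\<close>

lemma I2_even_iff: "cls x \<in> I2_even \<longleftrightarrow> even (length x)"
proof -
  have "even (length r)" if "r \<in> I2_relators m" for r
    using that by (auto simp: I2_relators_def length_concat sum_list_replicate)
  then have "even (length y) \<longleftrightarrow> even (length z)" if "cls y = cls z" for y z
    using word_eq_even_length that unfolding word_class_eq_iff by blast
  then show ?thesis
    unfolding I2_even_def by blast
qed

lemma parity_group_I2: "parity_group W (I2_gens m) I2_even"
proof -
  interpret group W by (rule group_I2)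
  have gens: "\<exists>c. a = cls [(c, True)]" if "a \<in> I2_gens m" for a
    using that by (auto simp: I2_gens_def)
  show ?thesis
  proof
    show "I2_gens m \<subseteq> carrier W"
      using gens by (auto simp: carrier_I2)
    show "a \<otimes>\<^bsub>W\<^esub> a = \<one>\<^bsub>W\<^esub>" if "a \<in> I2_gens m" for a
      using gens[OF that] by (auto simp: mult_cls I2_involution)
    have "\<exists>xs. set xs \<subseteq> I2_gens m \<and> foldr (\<otimes>\<^bsub>W\<^esub>) xs \<one>\<^bsub>W\<^esub> = cls x" for x
    proof (induction x)
      case Nil
      show ?case by (rule exI[of _ "[]"]) (simp add: one_I2)
    next
      case (Cons p x)
      then obtain xs where "set xs \<subseteq> I2_gens m" "foldr (\<otimes>\<^bsub>W\<^esub>) xs \<one>\<^bsub>W\<^esub> = cls x"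
        by blast
      then show ?case
        using cls_Cons[of p x] cls_gen[of "fst p"]
        by (intro exI[of _ "cls [(fst p, True)] # xs"]) simp
    qed
    then show "\<exists>xs. set xs \<subseteq> I2_gens m \<and> foldr (\<otimes>\<^bsub>W\<^esub>) xs \<one>\<^bsub>W\<^esub> = w"
      if "w \<in> carrier W" for w
      using that by (auto simp: carrier_I2)
    show "I2_even \<subseteq> carrier W"
      by (auto simp: I2_even_def carrier_I2)
    show "\<one>\<^bsub>W\<^esub> \<in> I2_even"
      by (simp add: one_I2 I2_even_iff)
    show "a \<otimes>\<^bsub>W\<^esub> w \<in> I2_even \<longleftrightarrow> w \<notin> I2_even" if "a \<in> I2_gens m" "w \<in> carrier W" for a w
      using gens[OF that(1)] that(2) by (auto simp: carrier_I2 mult_cls I2_even_iff)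
  qed
qed

lemma I2_rotation_closed: "cls [(Ls, True), (Lt, True)] \<in> carrier W"
  by (simp add: carrier_I2)

lemma I2_rotation_pow:
  "cls [(Ls, True), (Lt, True)] [^]\<^bsub>W\<^esub> n = cls (concat (replicate n [(Ls, True), (Lt, True)]))"
proof -
  interpret group W by (rule group_I2)
  show ?thesis
  proof (induction n)
    case 0
    show ?case by (simp add: one_I2)
  next
    case (Suc n)
    show ?case
      unfolding nat_pow_Suc2[OF I2_rotation_closed] Suc mult_cls by simp
  qed
qed

lemma I2_even_eq_generate: "I2_even = generate W {cls [(Ls, True), (Lt, True)]}"
proof -
  interpret group W by (rule group_I2)
  define H where "H = generate W {gs \<otimes>\<^bsub>W\<^esub> gt}"
  have s: "gs \<in> carrier W" and t: "gt \<in> carrier W"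
    by (auto simp: carrier_I2)
  have ss: "gs \<otimes>\<^bsub>W\<^esub> gs = \<one>\<^bsub>W\<^esub>" and tt: "gt \<otimes>\<^bsub>W\<^esub> gt = \<one>\<^bsub>W\<^esub>"
    by (simp_all add: mult_cls I2_involution)
  then have inv_st: "inv\<^bsub>W\<^esub> (gs \<otimes>\<^bsub>W\<^esub> gt) = gt \<otimes>\<^bsub>W\<^esub> gs"
    using s t by (simp add: inv_mult_group inv_equality)
  have H: "gs \<otimes>\<^bsub>W\<^esub> gt \<in> H" "gt \<otimes>\<^bsub>W\<^esub> gs \<in> H"
    using generate.incl[of "gs \<otimes>\<^bsub>W\<^esub> gt" "{gs \<otimes>\<^bsub>W\<^esub> gt}" W]
      generate.inv[of "gs \<otimes>\<^bsub>W\<^esub> gt" "{gs \<otimes>\<^bsub>W\<^esub> gt}" W] inv_st by (auto simp: H_def)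
  have H_mult: "x \<otimes>\<^bsub>W\<^esub> y \<in> H" if "x \<in> H" "y \<in> H" for x y
    using that by (auto simp: H_def intro: generate.eng)
  \<comment> \<open>These rewritings cover the effect of prepending \<open>s\<close> or
    \<open>t\<close> to a word, using only \<open>s s = 1\<close> and the elements
    \<open>s t\<close> and \<open>t s\<close> of \<open>H\<close>.\<close>
  have collapse: "gs \<otimes>\<^bsub>W\<^esub> (gs \<otimes>\<^bsub>W\<^esub> w) = w"
      "gs \<otimes>\<^bsub>W\<^esub> (gt \<otimes>\<^bsub>W\<^esub> w) = (gs \<otimes>\<^bsub>W\<^esub> gt) \<otimes>\<^bsub>W\<^esub> w"
      "gt \<otimes>\<^bsub>W\<^esub> w = (gt \<otimes>\<^bsub>W\<^esub> gs) \<otimes>\<^bsub>W\<^esub> (gs \<otimes>\<^bsub>W\<^esub> w)" if "w \<in> carrier W" for w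
  proof -
    show *: "gs \<otimes>\<^bsub>W\<^esub> (gs \<otimes>\<^bsub>W\<^esub> w) = w"
      using s that ss m_assoc[of gs gs w] by simp
    show "gs \<otimes>\<^bsub>W\<^esub> (gt \<otimes>\<^bsub>W\<^esub> w) = (gs \<otimes>\<^bsub>W\<^esub> gt) \<otimes>\<^bsub>W\<^esub> w"
      using s t that by (simp add: m_assoc)
    show "gt \<otimes>\<^bsub>W\<^esub> w = (gt \<otimes>\<^bsub>W\<^esub> gs) \<otimes>\<^bsub>W\<^esub> (gs \<otimes>\<^bsub>W\<^esub> w)"
      using s t that * m_assoc[of gt gs "gs \<otimes>\<^bsub>W\<^esub> w"] by simp
  qed
  \<comment> \<open>Removing one letter from an even word leaves an odd one, so the induction needs
    a claim for odd words too: they enter \<open>H\<close> after multiplication by \<open>s\<close>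
    on the left.\<close>
  have in_H: "(if even (length x) then cls x else gs \<otimes>\<^bsub>W\<^esub> cls x) \<in> H" for x
  proof (induction x)
    case Nil
    show ?case
      using generate.one[of W] by (simp add: H_def one_I2)
  next
    case (Cons p x)
    have "cls x \<in> carrier W"
      by (simp add: carrier_I2)
    then show ?case
      using Cons H H_mult collapse[of "cls x"] cls_Cons[of p x]
      by (cases "fst p"; cases "even (length x)") auto
  qed
  have "cls x \<in> H" if "even (length x)" for x
    using in_H[of x] that by simp
  then have "I2_even \<subseteq> H"
    by (auto simp: I2_even_def)
  moreover have "H \<subseteq> I2_even"
  \<comment> \<open>Conversely, \<open>s t\<close> and its inverse \<open>t s\<close> are words of
    length 2, and concatenation preserves even length.\<close>
  proof
    fix h assume "h \<in> H"
    then show "h \<in> I2_even"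
      unfolding H_def
    proof (induction rule: generate.induct)
      case one
      show ?case by (simp add: one_I2 I2_even_iff)
    next
      case (incl h)
      then show ?case by (simp add: mult_cls I2_even_iff)
    next
      case (inv h)
      then show ?case using inv_st by (simp add: mult_cls I2_even_iff)
    next
      case (eng h1 h2)
      then obtain x y where "h1 = cls x" "h2 = cls y" "even (length x)" "even (length y)"
        by (auto simp: I2_even_def)
      then show ?case by (simp add: mult_cls I2_even_iff)
    qed
  qed
  ultimately show ?thesis
    by (simp add: H_def mult_cls)
qed

text \<open>The third relator says that the \<open>m\<close>-th power of \<open>s t\<close> is
  trivial, so the order of \<open>s t\<close>, which is the size of the subgroup it generates,
  divides \<open>m\<close>.\<close>

lemma card_I2_even_dvd: "card I2_even dvd m"
proof -
  interpret group W by (rule group_I2)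
  have "cls (concat (replicate m [(Ls, True), (Lt, True)])) = cls []"
    unfolding word_class_eq_iff by (rule word_eq.relator) (simp add: I2_relators_def)
  then have "cls [(Ls, True), (Lt, True)] [^]\<^bsub>W\<^esub> m = \<one>\<^bsub>W\<^esub>"
    by (simp only: I2_rotation_pow one_I2)
  then show ?thesis
    using pow_eq_id[OF I2_rotation_closed, of m]
    by (simp add: I2_even_eq_generate generate_pow_card[OF I2_rotation_closed])
qed

end

theorem theorem6p5:
  fixes k :: nat
  shows "cube_like (I2_group (2 * k + 1)) (I2_gens (2 * k + 1))"
proof -
  interpret parity_group "I2_group (2 * k + 1)" "I2_gens (2 * k + 1)" "I2_even (2 * k + 1)"
    by (rule parity_group_I2)
  have "odd (card (I2_even (2 * k + 1)))"
    using card_I2_even_dvd[of "2 * k + 1"] by (meson dvd_trans even_plus_one_iff dvd_triv_left)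
  then show ?thesis
    \<comment> \<open>Either generator can be the single element of \<open>J\<close>, so the letter
      in \<open>cls_gen\<close> is left open.\<close>
    by (rule cube_like_if_odd_card[OF cls_gen])
qed

end
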